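(* Let $V:\mathfrak{C}\to\mathfrak{U}$ be a game value map, where $v_T,w_\lambda\in\mathfrak{C}$ for all $T,\lambda>0$. Let a family of functions $U_T\in\mathfrak{U}$ $(T>0)$ be a supersolution for the payoffs $v_T$, and let the family of functions $V[w_\lambda]$ $(\lambda>0)$ be a subsolution for the payoffs $w_\lambda$. Further, let $U_T$ $(T>0)$ satisfy $$\limsup_{T\uparrow\infty}\ \sup_{p\in[1,p_0]}\ \sup_{\omega\in\Omega}\big(U_{Tp}(\omega)-U_T(\omega)\big)\le 0\qquad\forall p_0>1.$$ Then for every $\varepsilon>0$ there exists a natural $N$ such that $$V[w_\lambda](\omega)\le U_{1/\lambda}(\omega)+\varepsilon\qquad\forall\omega\in\Omega,\ \lambda\in(0,1/N).$$
   Context: Setting: $\mathbb{R}_+=[0,\infty)$. $\Omega$ is a nonempty set; $\mathbb{K}$ is a nonempty set of maps from $\mathbb{R}_+$ to $\Omega$; $g:\Omega\to[0,1]$ is such that for every $z\in\mathbb{K}$ the map $t\mapsto g(z(t))$ is Borel measurable. For $T,\lambda>0$ and $z\in\mathbb{K}$, $$v_T(z)=\frac1T\int_0^T g(z(t))\,dt,\qquad w_\lambda(z)=\lambda\int_0^\infty e^{-\lambda t}g(z(t))\,dt .$$ Game value map: $\mathfrak{U}$ is the set of all bounded maps $\Omega\to\mathbb{R}$. $\mathfrak{C}$ is a nonempty set of maps $\mathbb{K}\to\mathbb{R}$ such that $Ac+B\in\mathfrak{C}$ for all $c\in\mathfrak{C}$, $A\ge0$, $B\in\mathbb{R}$. A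 map $V:\mathfrak{C}\to\mathfrak{U}$ is a game value map if (1) $V[Ac+B]=A\,V[c]+B$ for all $c\in\mathfrak{C}$, $A\ge 0$, $B\in\mathbb{R}$; and (2) for $c_1,c_2\in\mathfrak{C}$, if $c_1(z)\le c_2(z)$ for all $z\in\mathbb{K}$ then $V[c_1](\omega)\le V[c_2](\omega)$ for all $\omega\in\Omega$. Auxiliary payoffs: for $\lambda,T,h>0$ and $U_*:\Omega\to\mathbb{R}$, define for $z\in\mathbb{K}$ $$\zeta^{U_*}_{h,T}(z)=\frac{1}{T+h}\int_0^h g(z(t))\,dt+\frac{T}{T+h}U_*(z(h)),\qquad \xi^{U_*}_{h,\lambda}(z)=\lambda\int_0^h e^{-\lambda t}g(z(t))\,dt+e^{-\lambda h}U_*(z(h)).$$ Sub-/supersolutions: A family $U_T\in\mathfrak{U}$ $(T>0)$ is a subsolution (supersolution) for the payoffs $v_T$ $(T>0)$ if for every $\varepsilon>0$ there is a natural $\bar T$ such that for all natural $h,T>\bar T$ the payoff $\zeta^{U_T}_{h,T}$ lies in $\mathfrak{C}$ and $U_{T+h}\le V[\zeta^{U_T}_{h,T}]+\varepsilon$ (respectively $U_{T+h}\ge V[\zeta^{U_T}_{h,T}]-\varepsilon$) on $\Omega$. A family $U_\lambda\in\mathfrak{U}$ $(\lambda>0)$ is a subsolution (supersolution) for the payoffs $w_\lambda$ $(\lambda>0)$ if for every $\varepsilon>0$ there is a natural $\bar T$ such that for all natural $h>\bar T$ and all positive $\lambda<1/\bar T$ the payoff $\xi^{U_\lambda}_{h,\lambda}$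 lies in $\mathfrak{C}$ and $U_\lambda\le V[\xi^{U_\lambda}_{h,\lambda}]+\varepsilon$ (respectively $U_\lambda\ge V[\xi^{U_\lambda}_{h,\lambda}]-\varepsilon$) on $\Omega$. *)

theory Defs
  imports "HOL-Analysis.Analysis" "HOL-Library.FuncSet"
begin

text \<open>
  Maps with a prescribed domain \<open>D\<close> are elements of \<open>D \<rightarrow>\<^sub>E R\<close>, so that equality of
  functions is equality on \<open>D\<close>. This applies to processes (domain \<open>{0..}\<close>), payoffs
  (domain \<open>K\<close>) and bounded maps (domain \<open>\<Omega>\<close>).
\<close>

definition processes :: "'w set \<Rightarrow> ('w \<Rightarrow> real) \<Rightarrow> (real \<Rightarrow> 'w) set \<Rightarrow> bool" where
  "processes \<Omega> g K \<longleftrightarrow> K \<noteq> {} \<and> K \<subseteq> {0..} \<rightarrow>\<^sub>E \<Omega> \<and>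
     (\<forall>z\<in>K. (\<lambda>t. g (z t)) \<in> borel_measurable (restrict_space borel {0..}))"

definition payoff_v :: "(real \<Rightarrow> 'w) set \<Rightarrow> ('w \<Rightarrow> real) \<Rightarrow> real \<Rightarrow> (real \<Rightarrow> 'w) \<Rightarrow> real" where
  "payoff_v K g T = (\<lambda>z\<in>K. (1 / T) * (LBINT t:{0..T}. g (z t)))"

definition payoff_w :: "(real \<Rightarrow> 'w) set \<Rightarrow> ('w \<Rightarrow> real) \<Rightarrow> real \<Rightarrow> (real \<Rightarrow> 'w) \<Rightarrow> real" where
  "payoff_w K g l = (\<lambda>z\<in>K. l * (LBINT t:{0..}. exp (- l * t) * g (z t)))"

definition bounded_maps :: "'w set \<Rightarrow> ('w \<Rightarrow> real) set" where
  "bounded_maps \<Omega> = {u \<in> \<Omega> \<rightarrow>\<^sub>E UNIV. bounded (u ` \<Omega>)}"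

definition payoff_class :: "(real \<Rightarrow> 'w) set \<Rightarrow> ((real \<Rightarrow> 'w) \<Rightarrow> real) set \<Rightarrow> bool" where
  "payoff_class K C \<longleftrightarrow> C \<noteq> {} \<and> C \<subseteq> K \<rightarrow>\<^sub>E UNIV \<and>
     (\<forall>c\<in>C. \<forall>A B. A \<ge> 0 \<longrightarrow> (\<lambda>z\<in>K. A * c z + B) \<in> C)"

definition game_value_map ::
  "'w set \<Rightarrow> (real \<Rightarrow> 'w) set \<Rightarrow> ((real \<Rightarrow> 'w) \<Rightarrow> real) set \<Rightarrow>
   (((real \<Rightarrow> 'w) \<Rightarrow> real) \<Rightarrow> 'w \<Rightarrow> real) \<Rightarrow> bool" where
  "game_value_map \<Omega> K C V \<longleftrightarrow>
     V \<in> C \<rightarrow> bounded_maps \<Omega> \<and>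
     (\<forall>c\<in>C. \<forall>A B. A \<ge> 0 \<longrightarrow>
        V (\<lambda>z\<in>K. A * c z + B) = (\<lambda>\<omega>\<in>\<Omega>. A * V c \<omega> + B)) \<and>
     (\<forall>c1\<in>C. \<forall>c2\<in>C. (\<forall>z\<in>K. c1 z \<le> c2 z) \<longrightarrow> (\<forall>\<omega>\<in>\<Omega>. V c1 \<omega> \<le> V c2 \<omega>))"

definition payoff_zeta ::
  "(real \<Rightarrow> 'w) set \<Rightarrow> ('w \<Rightarrow> real) \<Rightarrow> ('w \<Rightarrow> real) \<Rightarrow> real \<Rightarrow> real \<Rightarrow> (real \<Rightarrow> 'w) \<Rightarrow> real" where
  "payoff_zeta K g u h T =
     (\<lambda>z\<in>K. 1 / (T + h) * (LBINT t:{0..h}. g (z t)) + T / (T + h) * u (z h))"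

definition payoff_xi ::
  "(real \<Rightarrow> 'w) set \<Rightarrow> ('w \<Rightarrow> real) \<Rightarrow> ('w \<Rightarrow> real) \<Rightarrow> real \<Rightarrow> real \<Rightarrow> (real \<Rightarrow> 'w) \<Rightarrow> real" where
  "payoff_xi K g u h l =
     (\<lambda>z\<in>K. l * (LBINT t:{0..h}. exp (- l * t) * g (z t)) + exp (- l * h) * u (z h))"

text \<open>
  Families are indexed by positive reals; their values at nonpositive indices are never used.
  The thresholds are positive naturals: since \<open>1 / 0 = 0\<close>, the threshold \<open>0\<close> would make the
  condition \<open>l < 1 / N\<close> unsatisfiable for positive \<open>l\<close>.
\<close>

definition subsolution_v where
  "subsolution_v \<Omega> K g C V U \<longleftrightarrow>
     (\<forall>T>0. U T \<in> bounded_maps \<Omega>) \<and>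
     (\<forall>\<epsilon>>0. \<exists>N::nat. N > 0 \<and> (\<forall>(h::nat) (T::nat). h > N \<and> T > N \<longrightarrow>
        payoff_zeta K g (U (real T)) (real h) (real T) \<in> C \<and>
        (\<forall>\<omega>\<in>\<Omega>. U (real T + real h) \<omega> \<le>
           V (payoff_zeta K g (U (real T)) (real h) (real T)) \<omega> + \<epsilon>)))"
  for U :: "real \<Rightarrow> 'w \<Rightarrow> real"

definition supersolution_v where
  "supersolution_v \<Omega> K g C V U \<longleftrightarrow>
     (\<forall>T>0. U T \<in> bounded_maps \<Omega>) \<and>
     (\<forall>\<epsilon>>0. \<exists>N::nat. N > 0 \<and> (\<forall>(h::nat) (T::nat). h > N \<and> T > N \<longrightarrow>
        payoff_zeta K g (U (real T)) (real h) (real T) \<in> C \<and>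
        (\<forall>\<omega>\<in>\<Omega>. U (real T + real h) \<omega> \<ge>
           V (payoff_zeta K g (U (real T)) (real h) (real T)) \<omega> - \<epsilon>)))"
  for U :: "real \<Rightarrow> 'w \<Rightarrow> real"

definition subsolution_w where
  "subsolution_w \<Omega> K g C V U \<longleftrightarrow>
     (\<forall>l>0. U l \<in> bounded_maps \<Omega>) \<and>
     (\<forall>\<epsilon>>0. \<exists>N::nat. N > 0 \<and> (\<forall>(h::nat) (l::real). h > N \<and> 0 < l \<and> l < 1 / real N \<longrightarrow>
        payoff_xi K g (U l) (real h) l \<in> C \<and>
        (\<forall>\<omega>\<in>\<Omega>. U l \<omega> \<le> V (payoff_xi K g (U l) (real h) l) \<omega> + \<epsilon>)))"
  for U :: "real \<Rightarrow> 'w \<Rightarrow> real"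

definition supersolution_w where
  "supersolution_w \<Omega> K g C V U \<longleftrightarrow>
     (\<forall>l>0. U l \<in> bounded_maps \<Omega>) \<and>
     (\<forall>\<epsilon>>0. \<exists>N::nat. N > 0 \<and> (\<forall>(h::nat) (l::real). h > N \<and> 0 < l \<and> l < 1 / real N \<longrightarrow>
        payoff_xi K g (U l) (real h) l \<in> C \<and>
        (\<forall>\<omega>\<in>\<Omega>. U l \<omega> \<ge> V (payoff_xi K g (U l) (real h) l) \<omega> - \<epsilon>)))"
  for U :: "real \<Rightarrow> 'w \<Rightarrow> real"

end

theory Submission
  imports Defs
begin

text \<open>
  Put \<open>W = V[w\<^sub>\<lambda>]\<close>, \<open>n = \<lceil>1/\<lambda>\<rceil>\<close> and \<open>M = sup (W - U\<^sub>n)\<close>, and choose \<open>h\<close> close to \<open>\<delta> n\<close> for a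
  small fixed \<open>\<delta>\<close>. Since \<open>exp (-\<delta>) \<le> 1 - \<delta> + \<delta>\<^sup>2/2\<close> and \<open>U\<^sub>n\<^sub>-\<^sub>h \<ge> U\<^sub>n - e\<close> by the growth condition,
  \<open>\<xi>\<close> with final payoff \<open>W\<close> exceeds \<open>\<zeta>\<close> with final payoff \<open>U\<^sub>n\<^sub>-\<^sub>h\<close> by at most
  \<open>(1 - \<delta>) (M + e) + \<delta>\<^sup>2/2 + \<lambda>\<close>. Applying \<open>V\<close> and both solution properties yields
  \<open>M \<le> (1 - \<delta>) M + 3e + \<delta>\<^sup>2/2 + \<lambda>\<close>, hence \<open>M \<le> (3e + \<lambda>)/\<delta> + \<delta>/2\<close>, which is small once \<open>\<delta>\<close>
  and then \<open>e\<close> and \<open>\<lambda>\<close> are small.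
\<close>

section \<open>Estimates and integrals of the exponential\<close>

text \<open>Multiplying the bound by \<open>1 + x + x\<^sup>2 / 2\<close>, which is at most
  \<open>exp x\<close>, gives \<open>1 + x\<^sup>4 / 4\<close>, hence at least 1.\<close>

lemma exp_minus_le_quadratic:
  fixes x :: real
  assumes "0 \<le> x"
  shows "exp (- x) \<le> 1 - x + x\<^sup>2 / 2"
proof -
  have "(1 - x + x\<^sup>2 / 2) * (1 + x + x\<^sup>2 / 2) = 1 + (x\<^sup>2 / 2)\<^sup>2"
    by (simp add: algebra_simps power2_eq_square)
  moreover have "0 \<le> 1 - x + x\<^sup>2 / 2"
  proof -
    have "1 - x + x\<^sup>2 / 2 = ((x - 1)\<^sup>2 + 1) / 2"
      by (simp add: power2_eq_square field_simps)
    then show ?thesis by (simp only: zero_le_divide_iff) simp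
  qed
  ultimately have "1 \<le> (1 - x + x\<^sup>2 / 2) * exp x"
    using mult_left_mono[OF exp_lower_Taylor_quadratic[OF assms], of "1 - x + x\<^sup>2 / 2"]
      zero_le_power2[of "x\<^sup>2 / 2"] by linarith
  then show ?thesis
    by (simp add: exp_minus field_simps)
qed

lemma set_integrable_exp_minus:
  fixes l :: real
  assumes "0 < l"
  shows "set_integrable lborel {0..} (\<lambda>t. exp (- l * t))"
proof -
  have "(\<lambda>t. exp (- l * t)) integrable_on {0..}"
    using has_integral_exp_minus_to_infinity[OF assms] by blast
  then have "set_integrable lebesgue {0..} (\<lambda>t. exp (- l * t))"
    by (intro nonnegative_absolutely_integrable_1) auto
  then show ?thesis
    unfolding set_integrable_def by (subst (asm) integrable_completion) auto
qed

lemma set_lebesgue_integral_exp_minus: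
  fixes l :: real
  assumes "0 < l"
  shows "(LBINT t:{0..}. exp (- l * t)) = 1 / l"
  using set_borel_integral_eq_integral(2)[OF set_integrable_exp_minus[OF assms]]
    integral_unique[OF has_integral_exp_minus_to_infinity[OF assms, of 0]] by simp

section \<open>Integrability and bounds along a process\<close>

lemma process_payoff_bounds:
  assumes "processes \<Omega> g K" "g \<in> \<Omega> \<rightarrow> {0..1}" "z \<in> K" "0 \<le> t"
  shows "z t \<in> \<Omega>" "0 \<le> g (z t)" "g (z t) \<le> 1"
proof -
  show "z t \<in> \<Omega>"
    using assms unfolding processes_def by (auto simp: PiE_iff subset_iff)
  then show "0 \<le> g (z t)" "g (z t) \<le> 1"
    using assms(2) by auto
qed

text \<open>\<open>f\<close> dominates the product because \<open>g\<close> takes values in [0,1].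
  Measurability is known only on \<open>{0..}\<close>, so the running payoff is first extended by
  zero to the whole line.\<close>

lemma set_integrable_process:
  fixes f :: "real \<Rightarrow> real"
  assumes "processes \<Omega> g K" "g \<in> \<Omega> \<rightarrow> {0..1}" "z \<in> K"
    and "A \<in> sets borel" "A \<subseteq> {0..}" "set_integrable lborel A f" "f \<in> borel_measurable borel"
  shows "set_integrable lborel A (\<lambda>t. f t * g (z t))"
proof (rule set_integrable_bound[OF assms(6)])
  have "(\<lambda>t. indicat_real {0..} t *\<^sub>R g (z t)) \<in> borel_measurable borel"
    using assms(1,3) unfolding processes_def
    by (subst (asm) borel_measurable_restrict_space_iff) auto
  then have "(\<lambda>t. indicat_real A t * f t * (indicat_real {0..} t *\<^sub>R g (z t))) \<in> borel_measurable borel"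
    using assms(4,7) by measurable
  also have "(\<lambda>t. indicat_real A t * f t * (indicat_real {0..} t *\<^sub>R g (z t)))
      = (\<lambda>t. indicat_real A t *\<^sub>R (f t * g (z t)))"
    using assms(5) by (auto simp: indicator_def fun_eq_iff)
  finally show "set_borel_measurable lborel A (\<lambda>t. f t * g (z t))"
    unfolding set_borel_measurable_def by simp
  show "AE t in lborel. t \<in> A \<longrightarrow> norm (f t * g (z t)) \<le> norm (f t)"
    using process_payoff_bounds[OF assms(1-3)] assms(5)
    by (auto simp: abs_mult subset_iff intro!: mult_right_le_one_le)
qed

lemma payoff_w_bounds:
  assumes "processes \<Omega> g K" "g \<in> \<Omega> \<rightarrow> {0..1}" "z \<in> K" "0 < l"
  shows "0 \<le> payoff_w K g l z" "payoff_w K g l z \<le> 1"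
proof -
  note g = process_payoff_bounds(2,3)[OF assms(1-3)]
  have "0 \<le> (LBINT t:{0..}. exp (- l * t) * g (z t))"
    unfolding set_lebesgue_integral_def
    by (rule Bochner_Integration.integral_nonneg) (auto simp: g indicator_def)
  then show "0 \<le> payoff_w K g l z"
    using assms(3,4) by (simp add: payoff_w_def)
  have "(LBINT t:{0..}. exp (- l * t) * g (z t)) \<le> (LBINT t:{0..}. exp (- l * t))"
  proof (rule set_integral_mono)
    show exp: "set_integrable lborel {0..} (\<lambda>t. exp (- l * t))"
      by (rule set_integrable_exp_minus) fact
    show "set_integrable lborel {0..} (\<lambda>t. exp (- l * t) * g (z t))"
      by (rule set_integrable_process[OF assms(1-3) _ _ exp]) auto
  qed (simp add: g mult_left_le)
  then have "l * (LBINT t:{0..}. exp (- l * t) * g (z t)) \<le> l * (1 / l)"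
    using assms(4) by (intro mult_left_mono) (simp_all only: set_lebesgue_integral_exp_minus)
  then show "payoff_w K g l z \<le> 1"
    using assms(3,4) by (simp add: payoff_w_def)
qed

section \<open>Comparison of discounted and averaged payoffs\<close>

text \<open>The running parts differ by at most \<open>l\<close>, the cost of rounding
  \<open>1 / l\<close> up to \<open>n\<close>. The discount \<open>exp (- l * h)\<close> exceeds the
  weight \<open>1 - h / n\<close> of the final payoff by at most a quadratic term.\<close>

lemma payoff_xi_le_payoff_zeta:
  fixes n h l B :: real
  assumes K: "processes \<Omega> g K" "g \<in> \<Omega> \<rightarrow> {0..1}" "z \<in> K"
    and l: "0 < l" "1 / l \<le> n" "n \<le> 1 / l + 1" and h: "0 \<le> h" "h \<le> n"
    and w: "0 \<le> w (z h)" "w (z h) \<le> 1" "w (z h) \<le> u (z h) + B"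
  shows "payoff_xi K g w h l z \<le>
    payoff_zeta K g u h (n - h) z + ((1 - h / n) * B + (h / n)\<^sup>2 / 2 + l)"
proof -
  note g = process_payoff_bounds(2,3)[OF K]
  define I where "I = (LBINT t:{0..h}. g (z t))"
  define J where "J = (LBINT t:{0..h}. exp (- l * t) * g (z t))"
  define x where "x = h / n"
  have n: "0 < n"
    using l by (meson divide_pos_pos less_le_trans zero_less_one)
  have x: "0 \<le> x" "x \<le> 1"
    using n h by (auto simp: x_def)
  have int_1: "set_integrable lborel {0..h} (\<lambda>t. 1 :: real)"
    by (rule borel_integrable_atLeastAtMost') simp
  have int_g: "set_integrable lborel {0..h} (\<lambda>t. g (z t))"
    using set_integrable_process[OF K _ _ int_1] by simp
  have int_exp: "set_integrable lborel {0..h} (\<lambda>t. exp (- l * t) * g (z t))"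
    by (intro set_integrable_process[OF K] borel_integrable_atLeastAtMost' continuous_intros) auto
  have "J \<le> I"
    unfolding I_def J_def
    by (rule set_integral_mono[OF int_exp int_g]) (use l g in \<open>auto intro!: mult_left_le_one_le\<close>)
  have "I \<le> (LBINT t:{0..h}. 1)"
    unfolding I_def by (rule set_integral_mono[OF int_g int_1]) (simp add: g)
  then have "I \<le> h"
    using h by (simp add: set_lebesgue_integral_def)
  have "l * J \<le> l * I"
    using \<open>J \<le> I\<close> l by simp
  \<comment> \<open>Only the excess rate \<open>l - 1 / n\<close>, nonnegative and small, is paired
    with the crude bound \<open>I \<le> h\<close>.\<close>
  also have "l * I = I / n + (l - 1 / n) * I"
    by (simp add: algebra_simps)
  also have "(l - 1 / n) * I \<le> (l - 1 / n) * h"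
    using \<open>I \<le> h\<close> l n by (intro mult_left_mono) (auto simp: field_simps)
  also have "\<dots> = l * (n - 1 / l) * x"
    using l n by (simp add: x_def field_simps)
  also have "\<dots> \<le> l * 1 * 1"
    using l x by (intro mult_mono) auto
  finally have running: "l * J \<le> I / n + l"
    by simp
  have "x \<le> l * h"
    using frac_le[OF h(1) order_refl _ l(2)] l(1) by (simp add: x_def mult.commute)
  then have "exp (- l * h) \<le> 1 - x + x\<^sup>2 / 2"
    by (intro order_trans[OF _ exp_minus_le_quadratic[OF x(1)]]) simp
  then have "exp (- l * h) * w (z h) \<le> (1 - x + x\<^sup>2 / 2) * w (z h)"
    by (rule mult_right_mono) fact
  also have "\<dots> = (1 - x) * w (z h) + x\<^sup>2 / 2 * w (z h)"
    by (simp add: algebra_simps)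
  \<comment> \<open>The bound by \<open>u + B\<close> enters only with weight \<open>1 - x\<close>;
    the quadratic remainder uses \<open>w \<le> 1\<close>, so \<open>B\<close> is not multiplied by
    it.\<close>
  also have "\<dots> \<le> (1 - x) * (u (z h) + B) + x\<^sup>2 / 2 * 1"
    using x w by (intro add_mono mult_left_mono) auto
  finally have final: "exp (- l * h) * w (z h) \<le> (1 - x) * u (z h) + (1 - x) * B + x\<^sup>2 / 2"
    by (simp add: algebra_simps)
  have "payoff_zeta K g u h (n - h) z = I / n + (1 - x) * u (z h)"
    using n K(3) by (simp add: payoff_zeta_def I_def x_def field_simps)
  moreover have "payoff_xi K g w h l z = l * J + exp (- l * h) * w (z h)"
    using K(3) by (simp add: payoff_xi_def J_def)
  ultimately show ?thesis
    using running final by (simp add: x_def)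
qed

section \<open>Consequences of the game value axioms\<close>

lemma game_value_map_le_add_const:
  assumes "payoff_class K C" "game_value_map \<Omega> K C V" "c1 \<in> C" "c2 \<in> C"
    and "\<And>z. z \<in> K \<Longrightarrow> c1 z \<le> c2 z + B" "\<omega> \<in> \<Omega>"
  shows "V c1 \<omega> \<le> V c2 \<omega> + B"
proof -
  let ?c = "\<lambda>z\<in>K. 1 * c2 z + B"
  have "?c \<in> C"
    using assms(1,4) unfolding payoff_class_def by (meson zero_le_one)
  moreover have "\<forall>z\<in>K. c1 z \<le> ?c z"
    using assms(5) by simp
  ultimately have "V c1 \<omega> \<le> V ?c \<omega>"
    using assms(2,3,6) unfolding game_value_map_def by blast
  moreover have "V ?c = (\<lambda>\<omega>\<in>\<Omega>. 1 * V c2 \<omega> + B)"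
    using assms(2,4) unfolding game_value_map_def by (meson zero_le_one)
  ultimately show ?thesis
    using assms(6) by simp
qed

text \<open>Scaling any member of \<open>C\<close> by \<open>A = 0\<close> produces the
  constants.\<close>

lemma game_value_map_const:
  assumes "payoff_class K C" "game_value_map \<Omega> K C V" "\<omega> \<in> \<Omega>"
  shows "(\<lambda>z\<in>K. B) \<in> C" "V (\<lambda>z\<in>K. B) \<omega> = B"
proof -
  obtain c where "c \<in> C"
    using assms(1) unfolding payoff_class_def by blast
  then have "(\<lambda>z\<in>K. 0 * c z + B) \<in> C" "V (\<lambda>z\<in>K. 0 * c z + B) = (\<lambda>\<omega>\<in>\<Omega>. 0 * V c \<omega> + B)"
    using assms(1,2) unfolding payoff_class_def game_value_map_def by (meson order_refl)+
  then show "(\<lambda>z\<in>K. B) \<in> C" "V (\<lambda>z\<in>K. B) \<omega> = B"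
    using assms(3) by simp_all
qed

lemma value_payoff_w_bounds:
  assumes "processes \<Omega> g K" "g \<in> \<Omega> \<rightarrow> {0..1}" "payoff_class K C" "game_value_map \<Omega> K C V"
    and "payoff_w K g l \<in> C" "0 < l" "\<omega> \<in> \<Omega>"
  shows "0 \<le> V (payoff_w K g l) \<omega>" "V (payoff_w K g l) \<omega> \<le> 1"
proof -
  note w = payoff_w_bounds[OF assms(1,2) _ assms(6)]
  note const = game_value_map_const[OF assms(3,4,7)]
  note le = game_value_map_le_add_const[OF assms(3,4), where B = 0 and \<omega> = \<omega>]
  show "0 \<le> V (payoff_w K g l) \<omega>"
    using le[OF const(1)[of 0] assms(5)] w(1) assms(7) const(2)[of 0] by simp
  show "V (payoff_w K g l) \<omega> \<le> 1"
    using le[OF assms(5) const(1)[of 1]] w(2) assms(7) const(2)[of 1] by simp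
qed

section \<open>The growth condition in epsilon form\<close>

lemma Limsup_SUP_le_zeroD:
  fixes U :: "real \<Rightarrow> 'w \<Rightarrow> real"
  assumes "Limsup at_top (\<lambda>T::real. SUP p\<in>P. SUP \<omega>\<in>\<Omega>. ereal (U (T * p) \<omega> - U T \<omega>)) \<le> 0"
    and "0 < e"
  obtains T0 where "\<And>T p \<omega>. T \<ge> T0 \<Longrightarrow> p \<in> P \<Longrightarrow> \<omega> \<in> \<Omega> \<Longrightarrow> U (T * p) \<omega> \<le> U T \<omega> + e"
proof -
  let ?F = "\<lambda>T::real. SUP p\<in>P. SUP \<omega>\<in>\<Omega>. ereal (U (T * p) \<omega> - U T \<omega>)"
  have "Limsup at_top ?F < ereal e"
    using assms by (simp add: le_less_trans)
  then have "eventually (\<lambda>T. ?F T < ereal e) at_top"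
    by (rule Limsup_lessD)
  then obtain T0 where T0: "\<And>T. T \<ge> T0 \<Longrightarrow> ?F T < ereal e"
    by (auto simp: eventually_at_top_linorder)
  show ?thesis
  proof (rule that)
    fix T p \<omega>
    assume "T \<ge> T0" "p \<in> P" "\<omega> \<in> \<Omega>"
    have "ereal (U (T * p) \<omega> - U T \<omega>) \<le> ?F T"
      by (rule order_trans[OF SUP_upper[OF \<open>\<omega> \<in> \<Omega>\<close>] SUP_upper[OF \<open>p \<in> P\<close>]])
    then have "ereal (U (T * p) \<omega> - U T \<omega>) < ereal e"
      using T0[OF \<open>T \<ge> T0\<close>] by (rule le_less_trans)
    then show "U (T * p) \<omega> \<le> U T \<omega> + e"
      by simp
  qed
qed

section \<open>The contraction argument for the supremum \<open>M\<close>\<close>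

theorem proposition3:
  fixes \<Omega> :: "'w set"
    and g :: "'w \<Rightarrow> real"
    and K :: "(real \<Rightarrow> 'w) set"
    and C :: "((real \<Rightarrow> 'w) \<Rightarrow> real) set"
    and V :: "((real \<Rightarrow> 'w) \<Rightarrow> real) \<Rightarrow> 'w \<Rightarrow> real"
    and U :: "real \<Rightarrow> 'w \<Rightarrow> real"
  assumes "\<Omega> \<noteq> {}"
    and "g \<in> \<Omega> \<rightarrow> {0..1}"
    and "processes \<Omega> g K"
    and "payoff_class K C"
    and "game_value_map \<Omega> K C V"
    and "\<And>T. T > 0 \<Longrightarrow> payoff_v K g T \<in> C"
    and "\<And>l. l > 0 \<Longrightarrow> payoff_w K g l \<in> C"
    and "supersolution_v \<Omega> K g C V U"
    and "subsolution_w \<Omega> K g C V (\<lambda>l. V (payoff_w K g l))"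
    and "\<And>p0::real. p0 > 1 \<Longrightarrow>
      Limsup at_top (\<lambda>T::real. SUP p\<in>{1..p0}. SUP \<omega>\<in>\<Omega>. ereal (U (T * p) \<omega> - U T \<omega>)) \<le> 0"
  shows "\<forall>\<epsilon>>0. \<exists>N::nat. N > 0 \<and>
    (\<forall>\<omega>\<in>\<Omega>. \<forall>l. 0 < l \<and> l < 1 / real N \<longrightarrow> V (payoff_w K g l) \<omega> \<le> U (1 / l) \<omega> + \<epsilon>)"
proof (intro allI impI)
  fix \<epsilon> :: real
  assume "\<epsilon> > 0"
  define W where "W l = V (payoff_w K g l)" for l
  \<comment> \<open>\<open>1 / k\<close> plays the role of the small fraction
    \<open>\<delta>\<close>; \<open>k \<ge> 2\<close> keeps \<open>h\<close> at most half of
    \<open>n\<close>.\<close>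
  obtain k :: nat where k: "k \<ge> 2" "1 / real k \<le> \<epsilon>"
  proof -
    obtain j :: nat where "1 / \<epsilon> < real j"
      using reals_Archimedean2 by blast
    then have "1 / real (j + 2) \<le> \<epsilon>"
      using \<open>\<epsilon> > 0\<close> by (simp add: field_simps)
    then show ?thesis
      using that[of "j + 2"] by simp
  qed
  \<comment> \<open>Chosen so that \<open>8 * k * e = \<epsilon> / 4\<close> in the final
    estimate.\<close>
  define e where "e = \<epsilon> / (32 * real k)"
  have "e > 0"
    using \<open>\<epsilon> > 0\<close> k by (simp add: e_def)
  obtain N1 :: nat where N1: "\<And>h T \<omega>. h > N1 \<Longrightarrow> T > N1 \<Longrightarrow> \<omega> \<in> \<Omega> \<Longrightarrow>
      payoff_zeta K g (U (real T)) (real h) (real T) \<in> C \<and>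
      V (payoff_zeta K g (U (real T)) (real h) (real T)) \<omega> - e \<le> U (real T + real h) \<omega>"
    using assms(8) \<open>e > 0\<close> unfolding supersolution_v_def by meson
  obtain N2 :: nat where N2: "N2 > 0" "\<And>h l \<omega>. h > N2 \<Longrightarrow> 0 < l \<Longrightarrow> l < 1 / real N2 \<Longrightarrow> \<omega> \<in> \<Omega> \<Longrightarrow>
      payoff_xi K g (W l) (real h) l \<in> C \<and>
      W l \<omega> \<le> V (payoff_xi K g (W l) (real h) l) \<omega> + e"
    using assms(9) \<open>e > 0\<close> unfolding subsolution_w_def W_def by meson
  \<comment> \<open>Ratios up to 2 suffice: the growth bound is applied only from \<open>m\<close>
    to \<open>n\<close> and from \<open>1 / l\<close> to \<open>n\<close>.\<close>
  obtain T0 where T0: "\<And>T p \<omega>. T \<ge> T0 \<Longrightarrow> p \<in> {1..2} \<Longrightarrow> \<omega> \<in> \<Omega> \<Longrightarrow> U (T * p) \<omega> \<le> U T \<omega> + e"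
    using Limsup_SUP_le_zeroD[OF assms(10)[of 2] \<open>e > 0\<close>] by (metis one_less_numeral_iff semiring_norm(76))
  obtain T1 :: nat where T1: "T0 \<le> real T1" "1 / e \<le> real T1"
    using real_arch_simple[of "max T0 (1 / e)"] by auto
  \<comment> \<open>The factor \<open>k\<close> survives the division \<open>n div k\<close>, so
    \<open>h\<close> still passes every threshold.\<close>
  define N where "N = 2 * k * (N1 + N2 + T1 + 2)"
  have "N > 0"
    using k by (simp add: N_def)
  moreover have "W l \<omega>0 \<le> U (1 / l) \<omega>0 + \<epsilon>"
    if "\<omega>0 \<in> \<Omega>" "0 < l" "l < 1 / real N" for \<omega>0 l
  proof -
    \<comment> \<open>The supersolution property concerns natural durations only, hence the
      rounding; \<open>U_l\<close> later returns from \<open>n\<close> to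
      \<open>1 / l\<close>.\<close>
    define n where "n = nat \<lceil>1 / l\<rceil>"
    define h where "h = n div k"
    define m where "m = n - h"
    define x where "x = real h / real n"
    have "real N < 1 / l"
      using that \<open>N > 0\<close> by (simp add: field_simps)
    have n: "1 / l \<le> real n" "real n \<le> 1 / l + 1"
      using that by (simp_all add: n_def)
    have "N < n"
      using \<open>real N < 1 / l\<close> n by linarith
    have "2 * k * (N1 + N2 + T1 + 2) \<le> n"
      using \<open>N < n\<close> by (simp add: N_def)
    then have "2 * (N1 + N2 + T1 + 2) \<le> h"
      using k div_le_mono[of "2 * k * (N1 + N2 + T1 + 2)" n k] by (simp add: h_def)
    then have h: "h > N1" "h > N2" "h \<ge> T1" "h \<ge> 2"
      by auto
    have "k * h \<le> n" "n < k * h + k"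
      using k dividend_less_times_div[of k n] by (simp_all add: h_def)
    have "2 * h \<le> n"
      using \<open>k * h \<le> n\<close> mult_le_mono1[OF k(1), of h] by linarith
    then have m: "m + h = n" "h \<le> m"
      by (simp_all add: m_def)
    have real_m: "real m = real n - real h"
      using m by linarith
    have "n > 0"
      using \<open>N < n\<close> by simp
    have x: "0 \<le> x" "x \<le> 1 / real k" "1 / (2 * real k) \<le> x"
    proof -
      show "0 \<le> x"
        by (simp add: x_def)
      have "real k * real h \<le> real n"
        using \<open>k * h \<le> n\<close> by (metis of_nat_le_iff of_nat_mult)
      then show "x \<le> 1 / real k"
        using \<open>n > 0\<close> k by (simp add: x_def field_simps)
      \<comment> \<open>Taking the floor in \<open>n div k\<close> loses at most a factor 2, since
        \<open>h \<ge> 1\<close>.\<close>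
      have "n \<le> 2 * k * h"
        using \<open>n < k * h + k\<close> mult_le_mono2[of 1 h k] h(4) by linarith
      then have "real n \<le> 2 * real k * real h"
        by (metis of_nat_le_iff of_nat_mult of_nat_numeral)
      then show "1 / (2 * real k) \<le> x"
        using \<open>n > 0\<close> k by (simp add: x_def field_simps)
    qed
    have "l \<le> e"
    proof -
      have "T1 \<le> N"
        using k mult_le_mono[of 1 "2 * k" T1 "N1 + N2 + T1 + 2"] by (simp add: N_def)
      then have "1 / e \<le> 1 / l"
        using T1 \<open>real N < 1 / l\<close> by linarith
      then show ?thesis
        using \<open>e > 0\<close> that by (simp add: field_simps)
    qed
    have "l < 1 / real N2"
    proof -
      have "N2 \<le> N"
        using k mult_le_mono[of 1 "2 * k" N2 "N1 + N2 + T1 + 2"] by (simp add: N_def)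
      then have "1 / real N \<le> 1 / real N2"
        using N2(1) by (simp add: frac_le)
      then show ?thesis
        using that by linarith
    qed
    have W: "0 \<le> W l \<omega>" "W l \<omega> \<le> 1" if "\<omega> \<in> \<Omega>" for \<omega>
      using value_payoff_w_bounds[OF assms(3,2,4,5) assms(7)[OF \<open>0 < l\<close>] \<open>0 < l\<close> that]
      by (simp_all add: W_def)
    have growth: "U b \<omega> \<le> U a \<omega> + e" if "T0 \<le> a" "0 < a" "a \<le> b" "b \<le> 2 * a" "\<omega> \<in> \<Omega>" for a b \<omega>
      using T0[of a "b / a" \<omega>] that by (simp add: field_simps)
    have U_m: "U (real n) \<omega> \<le> U (real m) \<omega> + e" if "\<omega> \<in> \<Omega>" for \<omega>
      using growth[of "real m" "real n"] that T1 m h by simp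
    have U_l: "U (real n) \<omega> \<le> U (1 / l) \<omega> + e" if "\<omega> \<in> \<Omega>" for \<omega>
    proof (rule growth)
      have "T1 + 1 \<le> N"
        using k mult_le_mono[of 1 "2 * k" "T1 + 1" "N1 + N2 + T1 + 2"] by (simp add: N_def)
      then have "real T1 + 1 < 1 / l"
        using \<open>real N < 1 / l\<close> by linarith
      then show "T0 \<le> 1 / l" "real n \<le> 2 * (1 / l)"
        using T1 n by linarith+
    qed (use \<open>0 < l\<close> n that in auto)
    define M where "M = (SUP \<omega>\<in>\<Omega>. W l \<omega> - U (real n) \<omega>)"
    have "bounded (U (real n) ` \<Omega>)"
      using assms(8) \<open>n > 0\<close> by (simp add: supersolution_v_def bounded_maps_def)
    then obtain b where b: "\<And>\<omega>. \<omega> \<in> \<Omega> \<Longrightarrow> \<bar>U (real n) \<omega>\<bar> \<le> b"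
      by (auto simp: bounded_iff)
    have "bdd_above ((\<lambda>\<omega>. W l \<omega> - U (real n) \<omega>) ` \<Omega>)"
    proof (rule bdd_aboveI2)
      show "W l \<omega> - U (real n) \<omega> \<le> 1 + b" if "\<omega> \<in> \<Omega>" for \<omega>
        using W(2)[OF that] b[OF that] by linarith
    qed
    then have M_upper: "W l \<omega> - U (real n) \<omega> \<le> M" if "\<omega> \<in> \<Omega>" for \<omega>
      unfolding M_def using that by (intro cSUP_upper)
    let ?B = "(1 - x) * (M + e) + x\<^sup>2 / 2 + l"
    \<comment> \<open>\<open>M\<close> also bounds the gap of the final payoffs at
      \<open>z h\<close>, so it reappears in \<open>?B\<close>, but with factor
      \<open>1 - x\<close>. Each solution property costs one \<open>e\<close>.\<close>
    have "M \<le> ?B + 2 * e"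
      unfolding M_def
    \<comment> \<open>Unfolding also expands the \<open>M\<close> inside \<open>?B\<close>; folding
      restores it there.\<close>
    proof (rule cSUP_least[OF assms(1)], fold M_def)
      fix \<omega>
      assume "\<omega> \<in> \<Omega>"
      let ?xi = "payoff_xi K g (W l) (real h) l"
      let ?zeta = "payoff_zeta K g (U (real m)) (real h) (real m)"
      have xi: "?xi \<in> C" "W l \<omega> \<le> V ?xi \<omega> + e"
        using N2(2)[OF h(2) \<open>0 < l\<close> \<open>l < 1 / real N2\<close> \<open>\<omega> \<in> \<Omega>\<close>] by auto
      have zeta: "?zeta \<in> C" "V ?zeta \<omega> - e \<le> U (real m + real h) \<omega>"
        using N1[OF h(1) _ \<open>\<omega> \<in> \<Omega>\<close>, of m] h(1) m(2) by auto
      have "?xi z \<le> ?zeta z + ?B" if "z \<in> K" for z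
      proof -
        have z: "z (real h) \<in> \<Omega>"
          using process_payoff_bounds(1)[OF assms(3,2) that] by simp
        have "W l (z (real h)) \<le> U (real m) (z (real h)) + (M + e)"
          using M_upper[OF z] U_m[OF z] by linarith
        then show ?thesis
          using payoff_xi_le_payoff_zeta[OF assms(3,2) that \<open>0 < l\<close> n, of "real h" "W l" "U (real m)" "M + e"]
            W[OF z] m(1) by (simp add: real_m x_def)
      qed
      then have "V ?xi \<omega> \<le> V ?zeta \<omega> + ?B"
        using game_value_map_le_add_const[OF assms(4,5) xi(1) zeta(1) _ \<open>\<omega> \<in> \<Omega>\<close>] by blast
      moreover have "real m + real h = real n"
        using m(1) by linarith
      ultimately show "W l \<omega> - U (real n) \<omega> \<le> ?B + 2 * e"
        using xi(2) zeta(2) by simp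
    qed
    moreover have "0 \<le> x * e"
      using x \<open>e > 0\<close> by simp
    \<comment> \<open>Moving \<open>(1 - x) * M\<close> to the left leaves the errors
      \<open>(1 - x) * e + l + 2 * e\<close>, at most \<open>4 * e\<close>.\<close>
    ultimately have "x * M \<le> x * (x / 2) + 4 * e"
      using \<open>l \<le> e\<close> by (simp add: algebra_simps power2_eq_square)
    \<comment> \<open>The lower bound \<open>1 / (2 * k) \<le> x\<close> makes the error a multiple
      of \<open>x\<close>, which can then be cancelled.\<close>
    also have "4 * e \<le> x * (8 * real k * e)"
      using mult_right_mono[OF x(3), of "8 * real k * e"] \<open>e > 0\<close> k by simp
    finally have "x * M \<le> x * (x / 2 + 8 * real k * e)"
      by (simp add: algebra_simps)
    moreover have "0 < x"
      using k by (intro less_le_trans[OF _ x(3)]) simp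
    ultimately have "M \<le> x / 2 + 8 * real k * e"
      by simp
    also have "\<dots> \<le> \<epsilon> / 2 + \<epsilon> / 4"
      using x(2) k by (simp add: e_def)
    finally have "M \<le> \<epsilon> / 2 + \<epsilon> / 4" .
    moreover have "e \<le> \<epsilon> / 4"
      using \<open>\<epsilon> > 0\<close> k by (simp add: e_def field_simps)
    ultimately show ?thesis
      using M_upper[OF that(1)] U_l[OF that(1)] by linarith
  qed
  ultimately show "\<exists>N::nat. N > 0 \<and>
      (\<forall>\<omega>\<in>\<Omega>. \<forall>l. 0 < l \<and> l < 1 / real N \<longrightarrow> V (payoff_w K g l) \<omega> \<le> U (1 / l) \<omega> + \<epsilon>)"
    unfolding W_def by blast
qed

end
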